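(* Let $(R_i)_{i\in S}$ be a family of nonzero commutative rings indexed by a set $S$, and let $R=\prod_{i\in S}R_i$. Then the following statements are equivalent. (i) $R$ has a wild prime. (ii) The index set $S$ is infinite. (iii) The set of wild primes of $R$ has cardinality $\geqslant 2^{2^{|S|}}$.
   Context: All rings are commutative with identity. For $k\in S$, $\pi_k:R\to R_k$ denotes the projection map. A tame prime of $R=\prod_{i\in S}R_i$ is a prime ideal of $R$ of the form $\pi_k^{-1}(\mathfrak p)$ for some $k\in S$ and some prime ideal $\mathfrak p$ of $R_k$. A wild prime of $R$ is a prime ideal of $R$ which is not tame. *)

theory Defs
  imports "HOL-Algebra.Algebra" "HOL-Library.Equipollence"
begin

text \<open>
  The product of a family of rings over a set S, with pointwise operations.  Elements are
  extensional functions (\<open>undefined\<close> outside S), so that two elements of the product that agree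
  on S are equal; hence every operation is restricted to S.
\<close>

definition product_ring :: "'i set \<Rightarrow> ('i \<Rightarrow> ('a, 'm) ring_scheme) \<Rightarrow> ('i \<Rightarrow> 'a) ring" where
  "product_ring S R =
    \<lparr> carrier = (\<Pi>\<^sub>E i\<in>S. carrier (R i)),
      monoid.mult = (\<lambda>x y. \<lambda>i\<in>S. x i \<otimes>\<^bsub>R i\<^esub> y i),
      one = (\<lambda>i\<in>S. \<one>\<^bsub>R i\<^esub>),
      ring.zero = (\<lambda>i\<in>S. \<zero>\<^bsub>R i\<^esub>),
      ring.add = (\<lambda>x y. \<lambda>i\<in>S. x i \<oplus>\<^bsub>R i\<^esub> y i) \<rparr>"

definition proj :: "'i \<Rightarrow> ('i \<Rightarrow> 'a) \<Rightarrow> 'a" where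
  "proj k x = x k"

definition tame_prime :: "'i set \<Rightarrow> ('i \<Rightarrow> ('a, 'm) ring_scheme) \<Rightarrow> ('i \<Rightarrow> 'a) set \<Rightarrow> bool" where
  "tame_prime S R P \<longleftrightarrow>
    primeideal P (product_ring S R) \<and>
    (\<exists>k\<in>S. \<exists>p. primeideal p (R k) \<and> P = proj k -` p \<inter> carrier (product_ring S R))"

definition wild_prime :: "'i set \<Rightarrow> ('i \<Rightarrow> ('a, 'm) ring_scheme) \<Rightarrow> ('i \<Rightarrow> 'a) set \<Rightarrow> bool" where
  "wild_prime S R P \<longleftrightarrow> primeideal P (product_ring S R) \<and> \<not> tame_prime S R P"

lemma product_ring_cring:
  assumes R: "\<And>i. i \<in> S \<Longrightarrow> cring (R i)"
  shows "cring (product_ring S R)"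
proof -
  let ?P = "product_ring S R"
  have mem: "x i \<in> carrier (R i)" if "x \<in> carrier ?P" "i \<in> S" for x i
    using that by (auto simp: product_ring_def)
  have memI: "(\<lambda>i\<in>S. f i) \<in> carrier ?P" if "\<And>i. i \<in> S \<Longrightarrow> f i \<in> carrier (R i)" for f
    using that by (simp add: product_ring_def)
  have eqI: "x = y"
    if "x \<in> carrier ?P" "y \<in> carrier ?P" "\<And>i. i \<in> S \<Longrightarrow> x i = y i" for x y
    using that by (auto simp: product_ring_def intro: PiE_ext)
  have add: "(x \<oplus>\<^bsub>?P\<^esub> y) i = x i \<oplus>\<^bsub>R i\<^esub> y i"
    and mult: "(x \<otimes>\<^bsub>?P\<^esub> y) i = x i \<otimes>\<^bsub>R i\<^esub> y i"
    and zero: "\<zero>\<^bsub>?P\<^esub> i = \<zero>\<^bsub>R i\<^esub>"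
    and one: "\<one>\<^bsub>?P\<^esub> i = \<one>\<^bsub>R i\<^esub>" if "i \<in> S" for x y i
    using that by (simp_all add: product_ring_def)
  have add_closed: "x \<oplus>\<^bsub>?P\<^esub> y \<in> carrier ?P" and mult_closed: "x \<otimes>\<^bsub>?P\<^esub> y \<in> carrier ?P"
    if "x \<in> carrier ?P" "y \<in> carrier ?P" for x y
    using that R mem[OF that(1)] mem[OF that(2)]
    by (simp_all add: product_ring_def cring.cring_simprules(1,5))
  have zero_closed: "\<zero>\<^bsub>?P\<^esub> \<in> carrier ?P" and one_closed: "\<one>\<^bsub>?P\<^esub> \<in> carrier ?P"
    using R by (simp_all add: product_ring_def cring.cring_simprules(2,6))
  note ops = add mult zero one
  note closed = add_closed mult_closed zero_closed one_closed
  show ?thesis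
  proof (rule cringI)
    show "abelian_group ?P"
    proof (rule abelian_groupI)
      fix x assume x: "x \<in> carrier ?P"
      have inv: "(\<lambda>i\<in>S. \<ominus>\<^bsub>R i\<^esub> x i) \<in> carrier ?P"
        using mem[OF x] R by (intro memI) (simp add: cring.cring_simprules(3))
      have "(\<lambda>i\<in>S. \<ominus>\<^bsub>R i\<^esub> x i) \<oplus>\<^bsub>?P\<^esub> x = \<zero>\<^bsub>?P\<^esub>"
        by (rule eqI) (simp_all add: ops closed inv x mem R cring.cring_simprules(9))
      with inv show "\<exists>y\<in>carrier ?P. y \<oplus>\<^bsub>?P\<^esub> x = \<zero>\<^bsub>?P\<^esub>"
        by blast
    next
      fix x y z assume "x \<in> carrier ?P" "y \<in> carrier ?P" "z \<in> carrier ?P"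
      then show "x \<oplus>\<^bsub>?P\<^esub> y \<oplus>\<^bsub>?P\<^esub> z = x \<oplus>\<^bsub>?P\<^esub> (y \<oplus>\<^bsub>?P\<^esub> z)"
        by (intro eqI) (simp_all add: ops closed mem R cring.cring_simprules(7))
    next
      fix x y assume "x \<in> carrier ?P" "y \<in> carrier ?P"
      then show "x \<oplus>\<^bsub>?P\<^esub> y = y \<oplus>\<^bsub>?P\<^esub> x"
        by (intro eqI) (simp_all add: ops closed mem R cring.cring_simprules(10))
    next
      fix x assume "x \<in> carrier ?P"
      then show "\<zero>\<^bsub>?P\<^esub> \<oplus>\<^bsub>?P\<^esub> x = x"
        by (intro eqI) (simp_all add: ops closed mem R cring.cring_simprules(8))
    qed (fact closed)+
    show "comm_monoid ?P"
    proof (rule comm_monoidI)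
      fix x y z assume "x \<in> carrier ?P" "y \<in> carrier ?P" "z \<in> carrier ?P"
      then show "x \<otimes>\<^bsub>?P\<^esub> y \<otimes>\<^bsub>?P\<^esub> z = x \<otimes>\<^bsub>?P\<^esub> (y \<otimes>\<^bsub>?P\<^esub> z)"
        by (intro eqI) (simp_all add: ops closed mem R cring.cring_simprules(11))
    next
      fix x y assume "x \<in> carrier ?P" "y \<in> carrier ?P"
      then show "x \<otimes>\<^bsub>?P\<^esub> y = y \<otimes>\<^bsub>?P\<^esub> x"
        by (intro eqI) (simp_all add: ops closed mem R cring.cring_simprules(14))
    next
      fix x assume "x \<in> carrier ?P"
      then show "\<one>\<^bsub>?P\<^esub> \<otimes>\<^bsub>?P\<^esub> x = x"
        by (intro eqI) (simp_all add: ops closed mem R cring.cring_simprules(12))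
    qed (fact closed)+
    fix x y z assume "x \<in> carrier ?P" "y \<in> carrier ?P" "z \<in> carrier ?P"
    then show "(x \<oplus>\<^bsub>?P\<^esub> y) \<otimes>\<^bsub>?P\<^esub> z = x \<otimes>\<^bsub>?P\<^esub> z \<oplus>\<^bsub>?P\<^esub> y \<otimes>\<^bsub>?P\<^esub> z"
      by (intro eqI) (simp_all add: ops closed mem R cring.cring_simprules(13))
  qed
qed

lemma proj_ring_hom: "k \<in> S \<Longrightarrow> proj k \<in> ring_hom (product_ring S R) (R k)"
  by (auto simp: product_ring_def proj_def ring_hom_def)

end

theory Submission
  imports Defs
begin

text \<open>
  If S is finite, some coordinate k has the property that every element vanishing at k lies in the
  prime P (otherwise a product of elements outside P is zero), so P is pulled back from the k-th
  factor.  If S is infinite, the Fichtenholz--Kantorovich--Hausdorff theorem gives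
  \<open>2 ^ |S|\<close> independent subsets of S.  Each choice, for every member of that family, of
  the set or its complement has together with the cofinite sets the finite intersection property;
  the elements vanishing on one of the chosen sets therefore lie in a common maximal ideal.  It is
  wild because it contains all elements of finite support, and different choices give comaximal
  ideals.
\<close>

section \<open>Independent families of sets\<close>

text \<open>For infinite \<open>S\<close>, both \<open>Fpow S\<close> and
  \<open>Fpow (Fpow S)\<close> are equipotent with \<open>S\<close>, and so is the product of the
  two because \<open>S \<times> S\<close> is. Hence each point of \<open>S\<close> can serve as a
  code for a finite set together with a finite family of finite sets.\<close>

lemma ex_finite_trace_coding:
  fixes S :: "'i set"
  assumes "infinite S"
  obtains h :: "'i \<Rightarrow> 'i set \<times> 'i set set" where "Fpow S \<times> Fpow (Fpow S) \<subseteq> h ` S"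
proof -
  have inf: "infinite (Fpow S)"
    using Fpow_infinite_bij_betw[OF assms] assms bij_betw_finite by blast
  obtain f where f: "bij_betw f (Fpow S) S"
    using Fpow_infinite_bij_betw[OF assms] by blast
  obtain g where g: "bij_betw g (Fpow (Fpow S)) (Fpow S)"
    using Fpow_infinite_bij_betw[OF inf] by blast
  obtain p where p: "bij_betw p (S \<times> S) S"
    using card_of_Times_same_infinite[OF assms] card_of_ordIso by blast
  have "bij_betw (map_prod f (f \<circ> g)) (Fpow S \<times> Fpow (Fpow S)) (S \<times> S)"
    using f g by (intro bij_betw_map_prod bij_betw_trans)
  then have "bij_betw (p \<circ> map_prod f (f \<circ> g)) (Fpow S \<times> Fpow (Fpow S)) S"
    using p by (rule bij_betw_trans)
  then show ?thesis
    using that bij_betw_imp_surj_on[OF bij_betw_inv_into] by (metis order_refl)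
qed

text \<open>One point from the symmetric difference of each pair of distinct members of
  \<open>\<T>\<close> suffices, and there are finitely many pairs. The claim covers all supersets
  \<open>F\<close> of \<open>E\<close> because \<open>E\<close> is enlarged by a point when it is
  used.\<close>

lemma ex_finite_separating_set:
  fixes S :: "'i set"
  assumes "finite \<T>" "\<T> \<subseteq> Pow S"
  shows "\<exists>E\<subseteq>S. finite E \<and> (\<forall>F. E \<subseteq> F \<longrightarrow> inj_on (\<lambda>Z. F \<inter> Z) \<T>)"
proof -
  define d where "d = (\<lambda>(U, V). SOME s :: 'i. s \<in> (U - V) \<union> (V - U))"
  have d: "d (U, V) \<in> (U - V) \<union> (V - U)" if "U \<noteq> V" for U V :: "'i set"
    unfolding d_def prod.case by (rule someI_ex) (use that in blast)
  let ?E = "d ` {(U, V) \<in> \<T> \<times> \<T>. U \<noteq> V}"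
  have "finite {(U, V) \<in> \<T> \<times> \<T>. U \<noteq> V}"
    by (rule finite_subset[of _ "\<T> \<times> \<T>"]) (use assms(1) in auto)
  then have "finite ?E"
    by simp
  moreover have "?E \<subseteq> S"
  proof (rule image_subsetI)
    fix q assume "q \<in> {(U, V) \<in> \<T> \<times> \<T>. U \<noteq> V}"
    then obtain U V where "q = (U, V)" "U \<in> \<T>" "V \<in> \<T>" "U \<noteq> V"
      by blast
    with d[of U V] assms(2) show "d q \<in> S"
      by blast
  qed
  moreover have "inj_on (\<lambda>Z. F \<inter> Z) \<T>" if "?E \<subseteq> F" for F
  proof (rule inj_onI, rule ccontr)
    fix U V assume UV: "U \<in> \<T>" "V \<in> \<T>" "F \<inter> U = F \<inter> V" "U \<noteq> V"
    then have "d (U, V) \<in> F"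
      using that by blast
    with d[OF UV(4)] UV(3) show False
      by blast
  qed
  ultimately show ?thesis
    by blast
qed

text \<open>Hausdorff's construction: a point coding \<open>(F, G)\<close> belongs to
  \<open>A Z\<close> when the trace \<open>F \<inter> Z\<close> is listed in \<open>G\<close>. For a
  prescribed pattern \<open>\<U>\<close> on \<open>\<T>\<close>, let \<open>F\<close> separate
  \<open>\<T>\<close> and let \<open>G\<close> list the traces of the members that should contain
  the point. The freedom to avoid a finite \<open>D\<close> makes the family independent modulo
  finite sets.\<close>

lemma ex_independent_family:
  fixes S :: "'i set"
  assumes S: "infinite S"
  obtains A :: "'i set \<Rightarrow> 'i set" where
    "\<And>\<T> \<U> D. \<lbrakk>finite \<T>; \<T> \<subseteq> Pow S; finite D\<rbrakk> \<Longrightarrow> \<exists>s\<in>S - D. \<forall>Z\<in>\<T>. s \<in> A Z \<longleftrightarrow> Z \<in> \<U>"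
proof -
  obtain h where h: "Fpow S \<times> Fpow (Fpow S) \<subseteq> h ` S"
    using ex_finite_trace_coding[OF S] by blast
  define A where "A Z = {s. fst (h s) \<inter> Z \<in> snd (h s)}" for Z
  show ?thesis
  proof (rule that[of A])
    fix \<T> \<U> :: "'i set set" and D :: "'i set"
    assume \<T>: "finite \<T>" "\<T> \<subseteq> Pow S" and D: "finite D"
    obtain E where E: "E \<subseteq> S" "finite E" "\<And>F. E \<subseteq> F \<Longrightarrow> inj_on (\<lambda>Z. F \<inter> Z) \<T>"
      using ex_finite_separating_set[OF \<T>] by blast
    \<comment> \<open>Points of \<open>D\<close> code only finitely many first components, while
      \<open>E\<close> has infinitely many one-point enlargements inside \<open>S\<close>. An
      enlargement not coded by any point of \<open>D\<close> forces the point found below to lie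
      outside \<open>D\<close>.\<close>
    have "inj_on (\<lambda>t. insert t E) (S - E)"
      by (auto simp: inj_on_def)
    then have "infinite ((\<lambda>t. insert t E) ` (S - E))"
      using S E(2) by (simp add: finite_image_iff)
    moreover have "finite (fst ` h ` D)"
      using D by simp
    ultimately obtain t where t: "t \<in> S" "insert t E \<notin> fst ` h ` D"
      by (metis Diff_iff finite_subset image_subsetI)
    define F where "F = insert t E"
    define G where "G = (\<lambda>Z. F \<inter> Z) ` (\<T> \<inter> \<U>)"
    have F: "F \<in> Fpow S" and G: "G \<in> Fpow (Fpow S)"
      using E(1,2) t(1) \<T> by (auto simp: F_def G_def Fpow_def)
    then have "(F, G) \<in> h ` S"
      using h by blast
    then obtain s where s: "s \<in> S" "h s = (F, G)"
      by force
    have "s \<notin> D"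
      using s(2) t(2) by (force simp: F_def)
    moreover have "s \<in> A Z \<longleftrightarrow> Z \<in> \<U>" if "Z \<in> \<T>" for Z
    proof -
      have "inj_on (\<lambda>Z. F \<inter> Z) \<T>"
        by (rule E(3)) (auto simp: F_def)
      then have "F \<inter> Z \<in> G \<longleftrightarrow> Z \<in> \<T> \<inter> \<U>"
        unfolding G_def using that by (intro inj_on_image_mem_iff[where B = \<T>]) auto
      then show ?thesis
        using that by (simp add: A_def s(2))
    qed
    ultimately show "\<exists>s\<in>S - D. \<forall>Z\<in>\<T>. s \<in> A Z \<longleftrightarrow> Z \<in> \<U>"
      using s(1) by blast
  qed
qed

section \<open>Maximal ideals\<close>

lemma (in ideal) one_notin_if_proper: "carrier R \<noteq> I \<Longrightarrow> \<one> \<notin> I"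
  using one_imp_carrier by blast

text \<open>Krull's theorem by Zorn's lemma. Properness is written as not containing the unit, a
  condition that passes at once to unions of chains.\<close>

lemma (in cring) ex_maximalideal_above:
  assumes I: "ideal I R" "\<one> \<notin> I"
  shows "\<exists>M. maximalideal M R \<and> I \<subseteq> M"
proof -
  let ?A = "{J. ideal J R \<and> I \<subseteq> J \<and> \<one> \<notin> J}"
  have "\<exists>M\<in>?A. \<forall>J\<in>?A. M \<subseteq> J \<longrightarrow> J = M"
  proof (rule subset_Zorn_nonempty)
    show "?A \<noteq> {}"
      using I by blast
  next
    fix C assume C: "C \<noteq> {}" "subset.chain ?A C"
    then have "subset.chain {J. ideal J R} C"
      by (auto simp: pred_on.chain_def)
    with chain_Union_is_ideal[OF this] C show "\<Union>C \<in> ?A"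
      by (auto simp: pred_on.chain_def)
  qed
  then obtain M where "M \<in> ?A" and Zorn: "\<forall>J\<in>?A. M \<subseteq> J \<longrightarrow> J = M"
    by (rule bexE)
  then have M: "ideal M R" "I \<subseteq> M" "\<one> \<notin> M"
    by simp_all
  have "maximalideal M R"
  proof (rule maximalidealI[OF M(1)])
    show "carrier R \<noteq> M"
      using M(3) by blast
    show "J = M \<or> J = carrier R" if J: "ideal J R" "M \<subseteq> J" "J \<subseteq> carrier R" for J
    proof (cases "\<one> \<in> J")
      case True
      then show ?thesis
        using ideal.one_imp_carrier[OF J(1)] by simp
    next
      case False
      then show ?thesis
        using Zorn J(1,2) M(2) by simp
    qed
  qed
  with M(2) show ?thesis
    by blast
qed

section \<open>Prime ideals of products\<close>

locale cring_family =
  fixes S :: "'i set" and R :: "'i \<Rightarrow> ('a, 'm) ring_scheme"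
  assumes factor_cring: "\<And>i. i \<in> S \<Longrightarrow> cring (R i)"
begin

abbreviation Prod :: "('i \<Rightarrow> 'a) ring" where
  "Prod \<equiv> product_ring S R"

sublocale cring Prod
  by (rule product_ring_cring) (rule factor_cring)

section \<open>Coordinatewise arithmetic in the product\<close>

lemma Prod_mem: "x \<in> carrier Prod \<Longrightarrow> i \<in> S \<Longrightarrow> x i \<in> carrier (R i)"
  by (auto simp: product_ring_def)

lemma Prod_memI: "(\<And>i. i \<in> S \<Longrightarrow> f i \<in> carrier (R i)) \<Longrightarrow> (\<lambda>i\<in>S. f i) \<in> carrier Prod"
  by (simp add: product_ring_def)

lemma Prod_eqI:
  "\<lbrakk>x \<in> carrier Prod; y \<in> carrier Prod; \<And>i. i \<in> S \<Longrightarrow> x i = y i\<rbrakk> \<Longrightarrow> x = y"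
  by (auto simp: product_ring_def intro: PiE_ext)

lemma Prod_apply:
  assumes "i \<in> S"
  shows "(x \<oplus>\<^bsub>Prod\<^esub> y) i = x i \<oplus>\<^bsub>R i\<^esub> y i"
    and "(x \<otimes>\<^bsub>Prod\<^esub> y) i = x i \<otimes>\<^bsub>R i\<^esub> y i"
    and "\<zero>\<^bsub>Prod\<^esub> i = \<zero>\<^bsub>R i\<^esub>"
    and "\<one>\<^bsub>Prod\<^esub> i = \<one>\<^bsub>R i\<^esub>"
  using assms by (simp_all add: product_ring_def)

text \<open>Negation is not a field of the ring record, so its coordinates are obtained from
  uniqueness of additive inverses in \<open>R i\<close>.\<close>

lemma Prod_minus_apply:
  assumes "x \<in> carrier Prod" "i \<in> S"
  shows "(\<ominus>\<^bsub>Prod\<^esub> x) i = \<ominus>\<^bsub>R i\<^esub> x i"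
proof -
  interpret Ri: cring "R i"
    by (rule factor_cring[OF assms(2)])
  have "(\<ominus>\<^bsub>Prod\<^esub> x) i \<oplus>\<^bsub>R i\<^esub> x i = \<zero>\<^bsub>R i\<^esub>"
    using l_neg[OF assms(1)] Prod_apply(1,3)[OF assms(2)] by metis
  then show ?thesis
    using Ri.minus_equality Prod_mem assms a_inv_closed by metis
qed

section \<open>Primes over a finite index set\<close>

text \<open>Otherwise every \<open>k\<close> has an element outside \<open>P\<close> that vanishes
  at \<open>k\<close>. The product of these finitely many elements is zero, yet primality keeps it
  outside \<open>P\<close>.\<close>

lemma prime_absorbs_coordinate_kernel:
  assumes "finite S" "primeideal P Prod"
  shows "\<exists>k\<in>S. \<forall>x\<in>carrier Prod. x k = \<zero>\<^bsub>R k\<^esub> \<longrightarrow> x \<in> P"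
proof (rule ccontr)
  interpret P: primeideal P Prod by fact
  assume "\<not> ?thesis"
  then have out: "\<exists>x\<in>carrier Prod - P. x k = \<zero>\<^bsub>R k\<^esub>" if "k \<in> S" for k
    using that by blast
  have "\<exists>y\<in>carrier Prod - P. \<forall>k\<in>F. y k = \<zero>\<^bsub>R k\<^esub>" if "F \<subseteq> S" for F
    using finite_subset[OF that assms(1)] that
  proof (induction F rule: finite_induct)
    case empty
    show ?case
      using P.I_notcarr P.a_subset by blast
  next
    case (insert k F)
    then obtain y where y: "y \<in> carrier Prod - P" "\<forall>k\<in>F. y k = \<zero>\<^bsub>R k\<^esub>"
      by blast
    obtain x where x: "x \<in> carrier Prod - P" "x k = \<zero>\<^bsub>R k\<^esub>"
      using out insert.prems by blast
    have "x \<otimes>\<^bsub>Prod\<^esub> y \<in> carrier Prod - P"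
      using x(1) y(1) P.I_prime by blast
    moreover have "(x \<otimes>\<^bsub>Prod\<^esub> y) j = \<zero>\<^bsub>R j\<^esub>" if "j \<in> insert k F" for j
    proof -
      have j: "j \<in> S"
        using that insert.prems by blast
      interpret Rj: cring "R j"
        by (rule factor_cring[OF j])
      have "x j \<in> carrier (R j)" "y j \<in> carrier (R j)"
        using x y j Prod_mem by blast+
      moreover have "x j = \<zero>\<^bsub>R j\<^esub> \<or> y j = \<zero>\<^bsub>R j\<^esub>"
        using that x(2) y(2) by blast
      ultimately show ?thesis
        by (auto simp: Prod_apply(2)[OF j])
    qed
    ultimately show ?case
      by blast
  qed
  then obtain y where y: "y \<in> carrier Prod - P" "\<forall>k\<in>S. y k = \<zero>\<^bsub>R k\<^esub>"
    by blast
  then have "y = \<zero>\<^bsub>Prod\<^esub>"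
    by (intro Prod_eqI) (auto simp: Prod_apply)
  with y(1) show False
    using P.zero_closed by blast
qed

text \<open>Once \<open>P\<close> contains the kernel of the projection to \<open>k\<close>,
  membership in \<open>P\<close> depends only on the coordinate at \<open>k\<close>, so
  \<open>P\<close> is the preimage of a set \<open>p\<close> in \<open>R k\<close>; primality of
  \<open>p\<close> is inherited from \<open>P\<close>.\<close>

lemma tame_prime_if_finite:
  assumes fin: "finite S" and P: "primeideal P Prod"
  shows "tame_prime S R P"
proof -
  interpret P: primeideal P Prod by fact
  obtain k where k: "k \<in> S" and ker: "\<And>x. \<lbrakk>x \<in> carrier Prod; x k = \<zero>\<^bsub>R k\<^esub>\<rbrakk> \<Longrightarrow> x \<in> P"
    using prime_absorbs_coordinate_kernel[OF assms] by blast
  interpret Rk: cring "R k"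
    by (rule factor_cring[OF k])
  have coord: "x \<in> P" if "x \<in> carrier Prod" "y \<in> P" "x k = y k" for x y
  proof -
    have y: "y \<in> carrier Prod"
      using that P.a_subset by blast
    have "(x \<ominus>\<^bsub>Prod\<^esub> y) k = \<zero>\<^bsub>R k\<^esub>"
      using that y k Prod_mem by (simp add: a_minus_def Prod_apply Prod_minus_apply Rk.r_neg)
    then have "x \<ominus>\<^bsub>Prod\<^esub> y \<in> P"
      using that y by (intro ker) auto
    then have "x \<ominus>\<^bsub>Prod\<^esub> y \<oplus>\<^bsub>Prod\<^esub> y \<in> P"
      using that by blast
    also have "x \<ominus>\<^bsub>Prod\<^esub> y \<oplus>\<^bsub>Prod\<^esub> y = x"
      using that y by (simp add: a_minus_def a_assoc l_neg)
    finally show ?thesis .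
  qed
  \<comment> \<open>\<open>lift\<close> is a set-theoretic section of the projection to
    \<open>k\<close>. By \<open>coord\<close> the values at the other indices do not affect
    membership in \<open>P\<close>; zero is one choice.\<close>
  define lift where "lift a = (\<lambda>i\<in>S. if i = k then a else \<zero>\<^bsub>R i\<^esub>)" for a
  have lift_k: "lift a k = a" for a
    using k by (simp add: lift_def)
  have lift: "lift a \<in> carrier Prod" if "a \<in> carrier (R k)" for a
    unfolding lift_def using that factor_cring
    by (intro Prod_memI) (auto simp: cring.cring_simprules(2))
  define p where "p = {a \<in> carrier (R k). lift a \<in> P}"
  have p_iff: "x k \<in> p \<longleftrightarrow> x \<in> P" if "x \<in> carrier Prod" for x
    using that coord[of x "lift (x k)"] coord[of "lift (x k)" x] lift lift_k Prod_mem[OF that k]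
    by (auto simp: p_def)
  have p_carrier: "p \<subseteq> carrier (R k)"
    by (auto simp: p_def)
  note k_apply = Prod_apply[OF k] Prod_minus_apply[OF _ k]
  \<comment> \<open>Each law is checked by forming the operation in the product on lifted elements
    and reading off its coordinate at \<open>k\<close> through \<open>p_iff\<close>, without
    \<open>lift\<close> having to be a homomorphism.\<close>
  have "primeideal p (R k)"
  proof (rule primeidealI[OF _ Rk.is_cring])
    show "ideal p (R k)"
    proof (rule idealI[OF Rk.ring_axioms])
      show "subgroup p (add_monoid (R k))"
      proof (rule Rk.add.subgroupI[OF p_carrier])
        show "p \<noteq> {}"
          using p_iff[OF zero_closed] P.zero_closed by blast
        show "\<ominus>\<^bsub>R k\<^esub> a \<in> p" if "a \<in> p" for a
          using that p_iff[of "\<ominus>\<^bsub>Prod\<^esub> lift a"] P.a_inv_closed lift p_carrier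
          by (auto simp: k_apply lift_k p_def)
        show "a \<oplus>\<^bsub>R k\<^esub> b \<in> p" if "a \<in> p" "b \<in> p" for a b
          using that p_iff[of "lift a \<oplus>\<^bsub>Prod\<^esub> lift b"] P.a_closed lift p_carrier
          by (auto simp: k_apply lift_k p_def)
      qed
      show *: "r \<otimes>\<^bsub>R k\<^esub> a \<in> p" if "a \<in> p" "r \<in> carrier (R k)" for a r
        using that p_iff[of "lift r \<otimes>\<^bsub>Prod\<^esub> lift a"] P.I_l_closed lift p_carrier
        by (auto simp: k_apply lift_k p_def)
      show "a \<otimes>\<^bsub>R k\<^esub> r \<in> p" if "a \<in> p" "r \<in> carrier (R k)" for a r
        using *[OF that] that p_carrier Rk.m_comm by (metis subsetD)
    qed
    show "carrier (R k) \<noteq> p"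
      using p_iff[OF one_closed] P.one_notin_if_proper[OF P.I_notcarr] by (auto simp: k_apply)
    show "a \<in> p \<or> b \<in> p"
      if "a \<in> carrier (R k)" "b \<in> carrier (R k)" "a \<otimes>\<^bsub>R k\<^esub> b \<in> p" for a b
      using that p_iff[of "lift a \<otimes>\<^bsub>Prod\<^esub> lift b"] P.I_prime[of "lift a" "lift b"] lift
      by (auto simp: k_apply lift_k p_def)
  qed
  moreover have "P = proj k -` p \<inter> carrier Prod"
    using p_iff P.a_subset by (auto simp: proj_def)
  ultimately show ?thesis
    unfolding tame_prime_def using P k by blast
qed

section \<open>Primes from filter bases and wild primes\<close>

text \<open>These are the elements whose zero set belongs to the filter on \<open>S\<close>
  generated by \<open>\<B>\<close>. Sums are handled by the union of two finite subfamilies;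
  negatives and multiples keep the same one.\<close>

lemma ideal_vanishing_on_filter_base:
  "ideal {x \<in> carrier Prod. \<exists>\<F>. finite \<F> \<and> \<F> \<subseteq> \<B> \<and> (\<forall>i\<in>S \<inter> \<Inter>\<F>. x i = \<zero>\<^bsub>R i\<^esub>)} Prod"
    (is "ideal ?I Prod")
proof (rule idealI[OF ring_axioms])
  have memI: "x \<in> ?I"
    if "x \<in> carrier Prod" "finite \<F>" "\<F> \<subseteq> \<B>"
      "\<And>i. \<lbrakk>i \<in> S; i \<in> \<Inter>\<F>; cring (R i)\<rbrakk> \<Longrightarrow> x i = \<zero>\<^bsub>R i\<^esub>" for x \<F>
    using that factor_cring by blast
  show "subgroup ?I (add_monoid Prod)"
  proof (rule add.subgroupI)
    have "\<zero>\<^bsub>Prod\<^esub> \<in> ?I"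
      by (rule memI[of _ "{}"]) (auto simp: Prod_apply)
    then show "?I \<noteq> {}"
      by blast
    show "\<ominus>\<^bsub>Prod\<^esub> x \<in> ?I" if x: "x \<in> ?I" for x
    proof -
      obtain \<F> where "finite \<F>" "\<F> \<subseteq> \<B>" "\<forall>i\<in>S \<inter> \<Inter>\<F>. x i = \<zero>\<^bsub>R i\<^esub>"
        using x by blast
      then show ?thesis
        using x by (intro memI[of _ \<F>])
          (auto simp: Prod_minus_apply cring.cring_simprules(22))
    qed
    show "x \<oplus>\<^bsub>Prod\<^esub> y \<in> ?I" if xy: "x \<in> ?I" "y \<in> ?I" for x y
    proof -
      obtain \<F> \<G> where "finite \<F>" "\<F> \<subseteq> \<B>" "\<forall>i\<in>S \<inter> \<Inter>\<F>. x i = \<zero>\<^bsub>R i\<^esub>"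
        and "finite \<G>" "\<G> \<subseteq> \<B>" "\<forall>i\<in>S \<inter> \<Inter>\<G>. y i = \<zero>\<^bsub>R i\<^esub>"
        using xy by blast
      then show ?thesis
        using xy by (intro memI[of _ "\<F> \<union> \<G>"])
          (auto simp: Prod_apply cring.cring_simprules(2,8))
    qed
  qed auto
  show *: "y \<otimes>\<^bsub>Prod\<^esub> x \<in> ?I" if x: "x \<in> ?I" and y: "y \<in> carrier Prod" for x y
  proof -
    obtain \<F> where "finite \<F>" "\<F> \<subseteq> \<B>" "\<forall>i\<in>S \<inter> \<Inter>\<F>. x i = \<zero>\<^bsub>R i\<^esub>"
      using x by blast
    then show ?thesis
      using x y Prod_mem[OF y] by (intro memI[of _ \<F>])
        (auto simp: Prod_apply cring.cring_simprules(27))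
  qed
  show "x \<otimes>\<^bsub>Prod\<^esub> y \<in> ?I" if "x \<in> ?I" "y \<in> carrier Prod" for x y
    using *[OF that] that m_comm[of x y] by simp
qed

text \<open>The unit vanishes at no index, since the factors are nonzero, while every finite
  intersection meets \<open>S\<close>. So the ideal is proper and lies in a maximal, hence prime,
  ideal.\<close>

lemma ex_prime_vanishing_on_filter_base:
  assumes nontriv: "\<And>i. i \<in> S \<Longrightarrow> carrier (R i) \<noteq> {\<zero>\<^bsub>R i\<^esub>}"
    and fip: "\<And>\<F>. \<lbrakk>finite \<F>; \<F> \<subseteq> \<B>\<rbrakk> \<Longrightarrow> S \<inter> \<Inter>\<F> \<noteq> {}"
  shows "\<exists>P. primeideal P Prod \<and>
    (\<forall>B\<in>\<B>. \<forall>x\<in>carrier Prod. (\<forall>i\<in>S \<inter> B. x i = \<zero>\<^bsub>R i\<^esub>) \<longrightarrow> x \<in> P)"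
proof -
  let ?I = "{x \<in> carrier Prod. \<exists>\<F>. finite \<F> \<and> \<F> \<subseteq> \<B> \<and> (\<forall>i\<in>S \<inter> \<Inter>\<F>. x i = \<zero>\<^bsub>R i\<^esub>)}"
  have "\<one>\<^bsub>Prod\<^esub> \<notin> ?I"
  proof
    assume "\<one>\<^bsub>Prod\<^esub> \<in> ?I"
    then obtain \<F> where \<F>: "finite \<F>" "\<F> \<subseteq> \<B>" "\<forall>i\<in>S \<inter> \<Inter>\<F>. \<one>\<^bsub>Prod\<^esub> i = \<zero>\<^bsub>R i\<^esub>"
      by blast
    with fip[OF \<F>(1,2)] obtain i where i: "i \<in> S" "\<one>\<^bsub>Prod\<^esub> i = \<zero>\<^bsub>R i\<^esub>"
      by blast
    interpret Ri: cring "R i"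
      by (rule factor_cring[OF i(1)])
    have "\<one>\<^bsub>R i\<^esub> = \<zero>\<^bsub>R i\<^esub>"
      using i by (simp add: Prod_apply)
    then show False
      using nontriv[OF i(1)] Ri.one_zeroD by blast
  qed
  then obtain M where M: "maximalideal M Prod" "?I \<subseteq> M"
    using ex_maximalideal_above[OF ideal_vanishing_on_filter_base] by blast
  have "x \<in> M" if "B \<in> \<B>" "x \<in> carrier Prod" "\<forall>i\<in>S \<inter> B. x i = \<zero>\<^bsub>R i\<^esub>" for B x
  proof -
    have "finite {B} \<and> {B} \<subseteq> \<B> \<and> (\<forall>i\<in>S \<inter> \<Inter>{B}. x i = \<zero>\<^bsub>R i\<^esub>)"
      using that by simp
    then show ?thesis
      using that(2) M(2) by blast
  qed
  then show ?thesis
    using maximalideal_prime[OF M(1)] by blast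
qed

text \<open>The indicators of \<open>A\<close> and of its complement add up to the unit. This one
  contradiction yields both wildness and distinctness of the primes constructed below.\<close>

lemma not_vanishing_on_both_parts:
  assumes "primeideal P Prod"
    and A: "\<And>x. \<lbrakk>x \<in> carrier Prod; \<forall>i\<in>S \<inter> A. x i = \<zero>\<^bsub>R i\<^esub>\<rbrakk> \<Longrightarrow> x \<in> P"
    and A': "\<And>x. \<lbrakk>x \<in> carrier Prod; \<forall>i\<in>S - A. x i = \<zero>\<^bsub>R i\<^esub>\<rbrakk> \<Longrightarrow> x \<in> P"
  shows False
proof -
  interpret P: primeideal P Prod by fact
  \<comment> \<open>\<open>e B\<close> is the idempotent that vanishes exactly where it must: it is
    zero on \<open>B\<close> and one on the rest of \<open>S\<close>.\<close>
  define e where "e B = (\<lambda>i\<in>S. if i \<in> B then \<zero>\<^bsub>R i\<^esub> else \<one>\<^bsub>R i\<^esub>)" for B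
  have e: "e B \<in> carrier Prod" for B
    unfolding e_def using factor_cring
    by (intro Prod_memI) (auto simp: cring.cring_simprules(2,6))
  have "e A \<in> P"
    by (rule A[OF e]) (simp add: e_def)
  moreover have "e (- A) \<in> P"
    by (rule A'[OF e]) (simp add: e_def)
  ultimately have "e A \<oplus>\<^bsub>Prod\<^esub> e (- A) \<in> P"
    by (rule P.a_closed)
  also have "e A \<oplus>\<^bsub>Prod\<^esub> e (- A) = \<one>\<^bsub>Prod\<^esub>"
    using factor_cring
    by (intro Prod_eqI a_closed one_closed e) (auto simp: Prod_apply e_def cring.cring_simprules(2,6,8,16))
  finally show False
    using P.one_notin_if_proper[OF P.I_notcarr] by blast
qed

lemma wild_primes_lepoll:
  assumes nontriv: "\<And>i. i \<in> S \<Longrightarrow> carrier (R i) \<noteq> {\<zero>\<^bsub>R i\<^esub>}"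
    and S: "infinite S"
  shows "Pow (Pow S) \<lesssim> {P. wild_prime S R P}"
proof -
  obtain A :: "'i set \<Rightarrow> 'i set" where A:
    "\<And>\<T> \<U> D. \<lbrakk>finite \<T>; \<T> \<subseteq> Pow S; finite D\<rbrakk> \<Longrightarrow> \<exists>s\<in>S - D. \<forall>Z\<in>\<T>. s \<in> A Z \<longleftrightarrow> Z \<in> \<U>"
    using that by (rule ex_independent_family[OF S])
  define C where "C \<U> Z = (if Z \<in> \<U> then A Z else - A Z)" for \<U> Z
  \<comment> \<open>The sets \<open>- {k}\<close> put every element supported at a single index into
    the prime; this is what excludes tameness.\<close>
  define \<B> where "\<B> \<U> = C \<U> ` Pow S \<union> (\<lambda>k. - {k}) ` S" for \<U>
  have fip: "S \<inter> \<Inter>\<F> \<noteq> {}" if fin: "finite \<F>" and sub: "\<F> \<subseteq> \<B> \<U>" for \<F> \<U>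
  proof -
    \<comment> \<open>A finite subfamily splits into chosen sets, indexed by a finite
      \<open>\<T>\<close>, and complements of the points of a finite \<open>D\<close>. Independence
      away from \<open>D\<close> supplies a common point.\<close>
    have "finite (\<F> \<inter> C \<U> ` Pow S)" "finite (\<F> \<inter> (\<lambda>k. - {k}) ` S)"
      using fin by simp_all
    note images = this[THEN finite_subset_image, OF Int_lower2]
    obtain \<T> where \<T>: "\<T> \<subseteq> Pow S" "finite \<T>" "\<F> \<inter> C \<U> ` Pow S = C \<U> ` \<T>"
      using images(1) by (elim exE conjE) (rule that)
    obtain D where D: "finite D" "\<F> \<inter> (\<lambda>k. - {k}) ` S = (\<lambda>k. - {k}) ` D"
      using images(2) by blast
    obtain s where s: "s \<in> S - D" "\<forall>Z\<in>\<T>. s \<in> A Z \<longleftrightarrow> Z \<in> \<U>"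
      using A[OF \<T>(2,1) D(1)] by blast
    have "\<F> = C \<U> ` \<T> \<union> (\<lambda>k. - {k}) ` D"
      unfolding \<T>(3)[symmetric] D(2)[symmetric] using sub by (auto simp: \<B>_def)
    then have "s \<in> \<Inter>\<F>"
      using s by (auto simp: C_def)
    with s(1) show ?thesis
      by blast
  qed
  have "\<forall>\<U>. \<exists>P. primeideal P Prod \<and>
    (\<forall>B\<in>\<B> \<U>. \<forall>x\<in>carrier Prod. (\<forall>i\<in>S \<inter> B. x i = \<zero>\<^bsub>R i\<^esub>) \<longrightarrow> x \<in> P)"
    by (intro allI ex_prime_vanishing_on_filter_base nontriv fip)
  from choice[OF this] obtain W where "\<forall>\<U>. primeideal (W \<U>) Prod \<and>
    (\<forall>B\<in>\<B> \<U>. \<forall>x\<in>carrier Prod. (\<forall>i\<in>S \<inter> B. x i = \<zero>\<^bsub>R i\<^esub>) \<longrightarrow> x \<in> W \<U>)"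
    by (rule exE)
  then have W: "\<And>\<U>. primeideal (W \<U>) Prod"
    and W_mem: "\<And>\<U> B x. \<lbrakk>B \<in> \<B> \<U>; x \<in> carrier Prod; \<forall>i\<in>S \<inter> B. x i = \<zero>\<^bsub>R i\<^esub>\<rbrakk> \<Longrightarrow> x \<in> W \<U>"
    by simp_all
  have "wild_prime S R (W \<U>)" for \<U>
    unfolding wild_prime_def tame_prime_def
  proof (intro conjI notI W)
    assume "primeideal (W \<U>) Prod \<and>
      (\<exists>k\<in>S. \<exists>p. primeideal p (R k) \<and> W \<U> = proj k -` p \<inter> carrier Prod)"
    then obtain k p where k: "k \<in> S" and p: "primeideal p (R k)"
      and Wp: "W \<U> = proj k -` p \<inter> carrier Prod"
      by blast
    interpret p: primeideal p "R k" by fact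
    \<comment> \<open>A pullback from \<open>k\<close> contains all elements vanishing at
      \<open>k\<close>, and \<open>- {k}\<close> contributes those vanishing elsewhere.\<close>
    show False
    proof (rule not_vanishing_on_both_parts[OF W, of "{k}" \<U>])
      show "x \<in> W \<U>" if "x \<in> carrier Prod" "\<forall>i\<in>S \<inter> {k}. x i = \<zero>\<^bsub>R i\<^esub>" for x
        using that k p.zero_closed by (auto simp: Wp proj_def)
      show "x \<in> W \<U>" if "x \<in> carrier Prod" "\<forall>i\<in>S - {k}. x i = \<zero>\<^bsub>R i\<^esub>" for x
        using that k by (intro W_mem[of "- {k}"]) (auto simp: \<B>_def)
    qed
  qed
  moreover have "inj_on W (Pow (Pow S))"
  proof (rule inj_onI, rule ccontr)
    fix \<U> \<V>
    assume UV: "\<U> \<in> Pow (Pow S)" "\<V> \<in> Pow (Pow S)" "W \<U> = W \<V>" "\<U> \<noteq> \<V>"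
    from UV(4) obtain Z where Z: "Z \<in> \<U> \<longleftrightarrow> Z \<notin> \<V>"
      by (auto simp: set_eq_iff)
    then have "Z \<in> Pow S"
      using UV(1,2) by (cases "Z \<in> \<U>") auto
    then have Z_mem: "C \<U> Z \<in> \<B> \<U>" "C \<V> Z \<in> \<B> \<V>"
      by (simp_all add: \<B>_def)
    \<comment> \<open>At an index \<open>Z\<close> where the two choices differ, the chosen sets are
      complementary in \<open>S\<close>, so a common prime would absorb both vanishing
      conditions.\<close>
    have compl: "S - C \<U> Z = S \<inter> C \<V> Z"
      using Z by (auto simp: C_def)
    show False
    proof (rule not_vanishing_on_both_parts[OF W, of "C \<U> Z" \<U>])
      show "x \<in> W \<U>" if "x \<in> carrier Prod" "\<forall>i\<in>S \<inter> C \<U> Z. x i = \<zero>\<^bsub>R i\<^esub>" for x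
        using W_mem[OF Z_mem(1) that] .
      show "x \<in> W \<U>" if "x \<in> carrier Prod" "\<forall>i\<in>S - C \<U> Z. x i = \<zero>\<^bsub>R i\<^esub>" for x
        using W_mem[OF Z_mem(2) that[unfolded compl]] UV(3) by simp
    qed
  qed
  ultimately show ?thesis
    unfolding lepoll_def by (intro exI[of _ W]) auto
qed

end

theorem corollary2p15:
  fixes S :: "'i set" and R :: "'i \<Rightarrow> ('a, 'm) ring_scheme"
  assumes "\<And>i. i \<in> S \<Longrightarrow> cring (R i)"
    and "\<And>i. i \<in> S \<Longrightarrow> carrier (R i) \<noteq> {\<zero>\<^bsub>R i\<^esub>}"
  shows "((\<exists>P. wild_prime S R P) \<longleftrightarrow> infinite S) \<and>
         (infinite S \<longleftrightarrow> Pow (Pow S) \<lesssim> {P. wild_prime S R P})"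
proof -
  interpret cring_family S R
    by (rule cring_family.intro) (rule assms(1))
  have "infinite S" if "\<exists>P. wild_prime S R P"
    using that tame_prime_if_finite by (auto simp: wild_prime_def)
  \<comment> \<open>\<open>Pow (Pow S)\<close> is never empty, so an injection from it already
    exhibits a wild prime.\<close>
  moreover have "\<exists>P. wild_prime S R P" if "Pow (Pow S) \<lesssim> {P. wild_prime S R P}"
    using that by (auto simp: lepoll_def)
  moreover have "Pow (Pow S) \<lesssim> {P. wild_prime S R P}" if "infinite S"
    using wild_primes_lepoll[OF assms(2) that] by blast
  ultimately show ?thesis
    by blast
qed

end
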